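(* Let $R$ be a complex rational map of degree $d\ge 2$ on the Riemann sphere $\widehat{\mathbb{C}}$. If $R$ is strongly exceptional, that is, if its Julia set satisfies $\mathcal{J}_R\subseteq\{z\in\mathbb{C}:|z|=r\}$ for some $r>0$, then $h_{top}(Q)=0$.
   Context: For $z\in\mathbb{C}$ put $d_{FS}(0,z)=\frac{2}{\pi}\arccos\sqrt{\frac{1}{1+|z|^2}}$ and put $d_{FS}(0,\infty)=1$ (normalized Fubini-Study distance to the origin on $\widehat{\mathbb{C}}=\mathbb{CP}^1$). For $z_0\in\widehat{\mathbb{C}}$ write $z_n=R^n(z_0)$, where $R^n$ is the $n$-th iterate. There exists $N\in\mathbb{N}_0$ (depending on $R$) such that whenever $d_{FS}(0,z_n)=d_{FS}(0,w_n)$ for all $n\le N$, then $d_{FS}(0,z_n)=d_{FS}(0,w_n)$ for all $n\in\mathbb{N}_0$; fix such an $N$. Define $\Phi:\widehat{\mathbb{C}}\to[0,1]^{N+1}$ by $\Phi(z_0)=(d_{FS}(0,z_0),\ldots,d_{FS}(0,z_N))$, let $\widehat{\Omega}=\Phi(\widehat{\mathbb{C}})$ (a compact set), and let $Q:\widehat{\Omega}\to\widehat{\Omega}$ be the (well-defined, continuous) map with $Q\circ\Phi=\Phi\circ R$. Here $h_{top}$ denotes topological entropy. *)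

theory Defs
  imports
    "HOL-Analysis.Analysis"
    "HOL-Computational_Algebra.Computational_Algebra"
begin

section \<open>The Riemann sphere\<close>

datatype riemann_sphere = Fin complex | Infty

text \<open>Inverse stereographic projection onto the unit sphere of \<open>\<complex> \<times> \<real>\<close>. The metric on the
  Riemann sphere is the chordal metric pulled back along it. It equals
  \<open>2 sin (\<pi> d / 2)\<close> for the normalized Fubini-Study distance \<open>d\<close>, so both metrics have the same
  topology and the same uniform convergence.\<close>

fun stereo :: "riemann_sphere \<Rightarrow> complex \<times> real" where
  "stereo (Fin z) =
     ((2 / (1 + (cmod z)\<^sup>2)) *\<^sub>R z, ((cmod z)\<^sup>2 - 1) / (1 + (cmod z)\<^sup>2))"
| "stereo Infty = (0, 1)"

lemma stereo_Fin_snd: "snd (stereo (Fin z)) = 1 - 2 / (1 + (cmod z)\<^sup>2)"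
proof -
  have "1 + (cmod z)\<^sup>2 \<noteq> 0"
    by (metis add_nonneg_eq_0_iff zero_le_one zero_le_power2 zero_neq_one)
  then show ?thesis by (simp add: field_simps)
qed

lemma stereo_eq_iff: "stereo x = stereo y \<longleftrightarrow> x = y"
proof
  assume eq: "stereo x = stereo y"
  have pos: "1 + (cmod z)\<^sup>2 > 0" for z
    by (simp add: add_pos_nonneg)
  show "x = y"
  proof (cases x; cases y)
    fix a b assume xy: "x = Fin a" "y = Fin b"
    have "2 / (1 + (cmod a)\<^sup>2) = 2 / (1 + (cmod b)\<^sup>2)"
      using arg_cong[OF eq, of snd] unfolding xy stereo_Fin_snd by simp
    moreover have "(2 / (1 + (cmod a)\<^sup>2)) *\<^sub>R a = (2 / (1 + (cmod b)\<^sup>2)) *\<^sub>R b"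
      using eq xy by simp
    moreover have "2 / (1 + (cmod b)\<^sup>2) \<noteq> 0" using pos[of b] by simp
    ultimately show ?thesis using xy by (metis scaleR_left_imp_eq)
  next
    fix a assume "x = Fin a" "y = Infty"
    then have "1 - 2 / (1 + (cmod a)\<^sup>2) = 1"
      using arg_cong[OF eq, of snd] stereo_Fin_snd[of a] by simp
    then show ?thesis using pos[of a] by simp
  next
    fix b assume "x = Infty" "y = Fin b"
    then have "1 - 2 / (1 + (cmod b)\<^sup>2) = 1"
      using arg_cong[OF eq, of snd] stereo_Fin_snd[of b] by simp
    then show ?thesis using pos[of b] by simp
  qed simp
qed simp

instantiation riemann_sphere :: metric_space
begin

definition dist_riemann_sphere :: "riemann_sphere \<Rightarrow> riemann_sphere \<Rightarrow> real" where
  "dist_riemann_sphere x y = dist (stereo x) (stereo y)"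

definition uniformity_riemann_sphere :: "(riemann_sphere \<times> riemann_sphere) filter" where
  "uniformity_riemann_sphere = (INF e\<in>{0<..}. principal {(x, y). dist x y < e})"

definition open_riemann_sphere :: "riemann_sphere set \<Rightarrow> bool" where
  "open_riemann_sphere U \<longleftrightarrow>
     (\<forall>x\<in>U. eventually (\<lambda>(x', y). x' = x \<longrightarrow> y \<in> U) uniformity)"

instance
  by standard
    (auto simp: dist_riemann_sphere_def uniformity_riemann_sphere_def
      open_riemann_sphere_def stereo_eq_iff dist_triangle2)

end

section \<open>Rational maps and their Julia sets\<close>

text \<open>For coprime \<open>p\<close>, \<open>q\<close> the map extends \<open>p / q\<close>; its value at infinity is the limit of
  \<open>p / q\<close>, read off from the coefficients in degree \<open>max (degree p) (degree q)\<close>.\<close>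

fun rat_eval :: "complex poly \<Rightarrow> complex poly \<Rightarrow> riemann_sphere \<Rightarrow> riemann_sphere" where
  "rat_eval p q (Fin z) = (if poly q z = 0 then Infty else Fin (poly p z / poly q z))"
| "rat_eval p q Infty =
     (let m = max (degree p) (degree q)
      in if coeff q m = 0 then Infty else Fin (coeff p m / coeff q m))"

definition rational_map :: "nat \<Rightarrow> (riemann_sphere \<Rightarrow> riemann_sphere) \<Rightarrow> bool" where
  "rational_map d R \<longleftrightarrow>
     (\<exists>p q. coprime p q \<and> max (degree p) (degree q) = d \<and> R = rat_eval p q)"

definition normal_family_on ::
    "'a::topological_space set \<Rightarrow> ('a \<Rightarrow> 'b::metric_space) set \<Rightarrow> bool" where
  "normal_family_on U F \<longleftrightarrow>
     (\<forall>f::nat \<Rightarrow> 'a \<Rightarrow> 'b. range f \<subseteq> F \<longrightarrow>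
        (\<exists>g k. strict_mono (k :: nat \<Rightarrow> nat) \<and>
           (\<forall>K. compact K \<and> K \<subseteq> U \<longrightarrow> uniform_limit K (f \<circ> k) g sequentially)))"

definition fatou_set :: "(riemann_sphere \<Rightarrow> riemann_sphere) \<Rightarrow> riemann_sphere set" where
  "fatou_set R = {z. \<exists>U. open U \<and> z \<in> U \<and> normal_family_on U (range (\<lambda>n. R ^^ n))}"

definition julia_set :: "(riemann_sphere \<Rightarrow> riemann_sphere) \<Rightarrow> riemann_sphere set" where
  "julia_set R = - fatou_set R"

definition strongly_exceptional :: "(riemann_sphere \<Rightarrow> riemann_sphere) \<Rightarrow> bool" where
  "strongly_exceptional R \<longleftrightarrow> (\<exists>r>0. julia_set R \<subseteq> Fin ` {z. cmod z = r})"

section \<open>The map \<open>\<Phi>\<close>\<close>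

fun fs_dist0 :: "riemann_sphere \<Rightarrow> real" where
  "fs_dist0 (Fin z) = 2 / pi * arccos (sqrt (1 / (1 + (cmod z)\<^sup>2)))"
| "fs_dist0 Infty = 1"

definition determining_bound :: "(riemann_sphere \<Rightarrow> riemann_sphere) \<Rightarrow> nat \<Rightarrow> bool" where
  "determining_bound R N \<longleftrightarrow>
     (\<forall>z w. (\<forall>n\<le>N. fs_dist0 ((R ^^ n) z) = fs_dist0 ((R ^^ n) w)) \<longrightarrow>
            (\<forall>n. fs_dist0 ((R ^^ n) z) = fs_dist0 ((R ^^ n) w)))"

text \<open>Points of \<open>\<real>\<^sup>N\<^sup>+\<^sup>1\<close> are represented as elements of the topological space
  \<^term>\<open>powertop_real {..N}\<close>, i.e. extensional functions on the index set \<open>{0, \<dots>, N}\<close>.\<close>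

definition Phi :: "(riemann_sphere \<Rightarrow> riemann_sphere) \<Rightarrow> nat \<Rightarrow> riemann_sphere \<Rightarrow> nat \<Rightarrow> real" where
  "Phi R N z = (\<lambda>n\<in>{..N}. fs_dist0 ((R ^^ n) z))"

definition Omega_hat :: "(riemann_sphere \<Rightarrow> riemann_sphere) \<Rightarrow> nat \<Rightarrow> (nat \<Rightarrow> real) topology" where
  "Omega_hat R N = subtopology (powertop_real {..N}) (range (Phi R N))"

section \<open>Topological entropy\<close>

text \<open>The definition of Adler, Konheim and McAndrew, for a continuous self-map of a compact space.\<close>

definition open_cover :: "'a topology \<Rightarrow> 'a set set \<Rightarrow> bool" where
  "open_cover X \<U> \<longleftrightarrow> (\<forall>U\<in>\<U>. openin X U) \<and> \<Union>\<U> = topspace X"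

text \<open>The join of the preimages of \<open>\<U>\<close> under the first \<open>n\<close> iterates, including the identity.\<close>

definition iterated_join :: "'a topology \<Rightarrow> ('a \<Rightarrow> 'a) \<Rightarrow> 'a set set \<Rightarrow> nat \<Rightarrow> 'a set set" where
  "iterated_join X f \<U> n =
     {{x \<in> topspace X. \<forall>i<n. (f ^^ i) x \<in> u i} | u. \<forall>i<n. u i \<in> \<U>}"

definition min_subcover_card :: "'a topology \<Rightarrow> 'a set set \<Rightarrow> nat" where
  "min_subcover_card X \<U> =
     (LEAST k. \<exists>\<V>. \<V> \<subseteq> \<U> \<and> finite \<V> \<and> \<Union>\<V> = topspace X \<and> card \<V> = k)"

definition cover_entropy :: "'a topology \<Rightarrow> ('a \<Rightarrow> 'a) \<Rightarrow> 'a set set \<Rightarrow> ereal" where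
  "cover_entropy X f \<U> =
     limsup (\<lambda>n. ereal (ln (real (min_subcover_card X (iterated_join X f \<U> n))) / real n))"

definition topological_entropy :: "'a topology \<Rightarrow> ('a \<Rightarrow> 'a) \<Rightarrow> ereal" where
  "topological_entropy X f = (SUP \<U>\<in>{\<U>. open_cover X \<U>}. cover_entropy X f \<U>)"

end

theory Submission
  imports Defs
begin

text \<open>All iterates of a point of the Julia set have modulus \<open>r\<close>, so \<open>\<Phi>\<close> collapses
  the Julia set to one point. Given an open cover, let \<open>U\<close> be a member that contains this point.
  The complement of \<open>\<Phi>\<^sup>-\<^sup>1(U)\<close> is a compact part of the Fatou set, where the iterates are
  equicontinuous, so finitely many itineraries, say \<open>m\<close>, describe all orbits starting there.
  An orbit of length \<open>n\<close> stays in \<open>\<Phi>\<^sup>-\<^sup>1(U)\<close> until it leaves it for the first time and then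
  follows one of these \<open>m\<close> itineraries. Hence \<open>1 + n m\<close> sets of the iterated join suffice, and
  this number grows subexponentially.\<close>

section \<open>Factors that collapse the set of non-equicontinuity\<close>

lemma funpow_semiconj:
  assumes "g \<circ> \<phi> = \<phi> \<circ> f"
  shows "(g ^^ n) (\<phi> x) = \<phi> ((f ^^ n) x)"
proof (induction n)
  case (Suc n)
  then show ?case using fun_cong[OF assms, of "(f ^^ n) x"] by simp
qed simp

section \<open>Subcover counts and cover entropy\<close>

lemma min_subcover_card_le:
  assumes "\<V> \<subseteq> \<U>" "finite \<V>" "\<Union>\<V> = topspace X"
  shows "min_subcover_card X \<U> \<le> card \<V>"
  unfolding min_subcover_card_def by (rule Least_le) (use assms in blast)

lemma cover_entropy_nonneg: "cover_entropy X f \<U> \<ge> 0"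
proof -
  have "ln (real k) / real n \<ge> 0" for k n
    \<comment> \<open>The count is 0 for an empty space; then the convention \<open>ln 0 = 0\<close>
      applies.\<close>
    by (cases "k = 0") auto
  then show ?thesis
    unfolding cover_entropy_def
    by (intro le_Limsup) (auto simp: zero_ereal_def)
qed

lemma cover_entropy_linear_growth:
  assumes "\<And>n. min_subcover_card X (iterated_join X f \<U> n) \<le> 1 + n * m"
  shows "cover_entropy X f \<U> = 0"
proof (rule antisym)
  let ?c = "\<lambda>n. min_subcover_card X (iterated_join X f \<U> n)"
  have le: "ln (real (?c n)) / real n \<le> ln (1 + real n * real m) / real n" for n
  proof (rule divide_right_mono)
    have "real (?c n) \<le> 1 + real n * real m"
      using assms[of n] by (metis of_nat_1 of_nat_add of_nat_le_iff of_nat_mult)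
    then show "ln (real (?c n)) \<le> ln (1 + real n * real m)"
      by (cases "?c n = 0") auto
  qed simp
  have "(\<lambda>n. ln (1 + real n * real m) / real n) \<longlonglongrightarrow> 0"
  proof (rule tendsto_sandwich[OF _ _ tendsto_const])
    \<comment> \<open>Since \<open>1 + n * m\<close> is at most \<open>n * (1 + m)\<close> for
      \<open>n\<close> at least 1, the logarithm splits into \<open>ln n\<close> and a constant,
      both negligible against \<open>n\<close>.\<close>
    have "ln (1 + real n * real m) / real n \<le> ln (real n) / real n + ln (1 + real m) / real n"
      if "n \<ge> 1" for n
    proof -
      have "ln (1 + real n * real m) \<le> ln (real n * (1 + real m))"
        using that by (intro ln_mono) (auto simp: distrib_left add_pos_nonneg)
      also have "\<dots> = ln (real n) + ln (1 + real m)"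
        using that by (intro ln_mult_pos) (auto simp: add_pos_nonneg)
      finally show ?thesis
        by (simp add: divide_right_mono flip: add_divide_distrib)
    qed
    then show "\<forall>\<^sub>F n in sequentially.
        ln (1 + real n * real m) / real n \<le> ln (real n) / real n + ln (1 + real m) / real n"
      by (auto simp: eventually_sequentially)
    show "(\<lambda>n. ln (real n) / real n + ln (1 + real m) / real n) \<longlonglongrightarrow> 0"
      using tendsto_add[OF lim_ln_over_n lim_const_over_n] by simp
  qed (auto intro!: always_eventually divide_nonneg_nonneg)
  then have lim: "limsup (\<lambda>n. ereal (ln (1 + real n * real m) / real n)) = 0"
    by (intro lim_imp_Limsup) (auto simp: zero_ereal_def)
  show "cover_entropy X f \<U> \<le> 0"
    unfolding cover_entropy_def lim[symmetric]
    by (rule Limsup_mono) (simp add: le)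
qed (rule cover_entropy_nonneg)

text \<open>The itinerary count for a general factor of a compact metric system. The constant
  \<open>m\<close> depends on the cover but not on \<open>n\<close>: it is the number of
  equicontinuity neighbourhoods that cover the complement of the preimage of one member.\<close>

lemma min_subcover_card_collapsed:
  fixes f :: "'a::metric_space \<Rightarrow> 'a"
  assumes compact: "compact (UNIV :: 'a set)"
    and cont: "continuous_map euclidean X \<phi>" and surj: "range \<phi> = topspace X"
    and semiconj: "g \<circ> \<phi> = \<phi> \<circ> f"
    and equicont: "\<And>x e. x \<notin> J \<Longrightarrow> e > 0 \<Longrightarrow>
      \<exists>U. open U \<and> x \<in> U \<and> (\<forall>n. \<forall>y\<in>U. dist ((f ^^ n) x) ((f ^^ n) y) < e)"
    and collapse: "\<And>x y. x \<in> J \<Longrightarrow> y \<in> J \<Longrightarrow> \<phi> x = \<phi> y"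
    and cover: "open_cover X \<U>"
  obtains m where "\<And>n. min_subcover_card X (iterated_join X g \<U> n) \<le> 1 + n * m"
proof -
  have op: "open (\<phi> -` U)" if "U \<in> \<U>" for U
    using openin_continuous_map_preimage[OF cont] cover that
    by (auto simp: open_cover_def vimage_def)
  have cov: "\<exists>U\<in>\<U>. \<phi> x \<in> U" for x
    using cover surj unfolding open_cover_def by (metis UnionE rangeI)
  \<comment> \<open>\<open>e\<close> is a Lebesgue number of the cover pulled back along
    \<open>\<phi>\<close>: all points within \<open>e\<close> of \<open>x\<close> lie in one common
    member.\<close>
  obtain e where "e > 0" and "\<forall>x\<in>UNIV. \<exists>B\<in>(\<lambda>U. \<phi> -` U) ` \<U>. ball x e \<subseteq> B"
    by (rule Heine_Borel_lemma[OF compact, of "(\<lambda>U. \<phi> -` U) ` \<U>"]) (use cov op in auto)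
  then have leb: "\<exists>U\<in>\<U>. ball x e \<subseteq> \<phi> -` U" for x by auto
  obtain U0 where U0: "U0 \<in> \<U>" "J \<subseteq> \<phi> -` U0"
  proof (cases "J = {}")
    case True
    then show ?thesis using cov that by auto
  next
    case False
    then obtain a where "a \<in> J" by auto
    obtain U where U: "U \<in> \<U>" "\<phi> a \<in> U" using cov by metis
    have "J \<subseteq> \<phi> -` U"
    proof
      fix x assume "x \<in> J"
      then show "x \<in> \<phi> -` U" using collapse[OF _ \<open>a \<in> J\<close>] U(2) by simp
    qed
    then show ?thesis using U(1) that by metis
  qed
  \<comment> \<open>This closed set misses \<open>J\<close>, so the iterates are equicontinuous at
    each of its points.\<close>
  define K where "K = - (\<phi> -` U0)"
  have "compact K"
    using compact_Int_closed[OF compact, of K] op[OF U0(1)] by (simp add: K_def closed_Compl)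
  have "\<exists>W. open W \<and> x \<in> W \<and> (\<forall>n. \<forall>y\<in>W. dist ((f ^^ n) x) ((f ^^ n) y) < e)" if "x \<in> K" for x
    using equicont[of x e] that U0 \<open>e > 0\<close> by (auto simp: K_def)
  then obtain W where W: "\<And>x. x \<in> K \<Longrightarrow> open (W x)" "\<And>x. x \<in> K \<Longrightarrow> x \<in> W x"
    "\<And>x n y. x \<in> K \<Longrightarrow> y \<in> W x \<Longrightarrow> dist ((f ^^ n) x) ((f ^^ n) y) < e"
    by metis
  have "\<And>T. T \<in> K \<Longrightarrow> open (W T)" "K \<subseteq> (\<Union>c\<in>K. W c)"
    using W by auto
  from compactE_image[OF \<open>compact K\<close> this]
  obtain Z where Z: "Z \<subseteq> K" "finite Z" "K \<subseteq> (\<Union>c\<in>Z. W c)" by metis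
  obtain u where u: "\<And>x. u x \<in> \<U>" "\<And>x. ball x e \<subseteq> \<phi> -` u x"
    using leb by metis
  \<comment> \<open>The orbit of \<open>y\<close> stays within \<open>e\<close> of the orbit of
    \<open>c\<close> for all time, so the one itinerary chosen along the orbit of \<open>c\<close>
    serves every point of \<open>W c\<close>.\<close>
  have follow: "\<phi> ((f ^^ n) y) \<in> u ((f ^^ n) c)" if "c \<in> Z" "y \<in> W c" for c y n
    using W(3)[of c y n] u(2)[of "(f ^^ n) c"] that Z(1) by (auto simp: subset_iff)
  \<comment> \<open>Here \<open>j\<close> stands for the first time the orbit meets
    \<open>K\<close>; from then on it follows the itinerary of the centre \<open>c\<close>, with the
    clock restarted at \<open>j\<close>.\<close>
  define itin where
    "itin j c t = (if t < j then U0 else u ((f ^^ (t - j)) c))" for j :: nat and c and t :: nat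
  define S where "S n s = {x \<in> topspace X. \<forall>i<n. (g ^^ i) x \<in> s i}"
    for n and s :: "nat \<Rightarrow> _ set"
  have "min_subcover_card X (iterated_join X g \<U> n) \<le> 1 + n * card Z" for n
  proof -
    \<comment> \<open>The extra set takes the orbits that avoid \<open>K\<close> at all times below
      \<open>n\<close>; every other orbit is sorted by its entry time \<open>j\<close> and by a
      centre \<open>c\<close>.\<close>
    define \<V> where "\<V> = insert (S n (\<lambda>_. U0)) ((\<lambda>(j, c). S n (itin j c)) ` ({..<n} \<times> Z))"
    have "\<V> \<subseteq> iterated_join X g \<U> n"
    proof -
      have "S n s \<in> iterated_join X g \<U> n" if "\<And>i. s i \<in> \<U>" for s
        using that unfolding iterated_join_def S_def by blast
      then show ?thesis
        using U0(1) u(1) by (auto simp: \<V>_def itin_def)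
    qed
    moreover have "finite \<V>"
      using Z(2) by (simp add: \<V>_def)
    moreover have "\<Union>\<V> = topspace X"
    proof
      show "\<Union>\<V> \<subseteq> topspace X" by (auto simp: \<V>_def S_def)
      show "topspace X \<subseteq> \<Union>\<V>"
      proof
        fix x assume x: "x \<in> topspace X"
        then obtain z where z: "x = \<phi> z" using surj by auto
        note it = funpow_semiconj[OF semiconj]
        show "x \<in> \<Union>\<V>"
        proof (cases "\<exists>j<n. (f ^^ j) z \<in> K")
          case False
          then have "x \<in> S n (\<lambda>_. U0)"
            using x by (auto simp: S_def z it K_def)
          then show ?thesis by (auto simp: \<V>_def)
        next
          case True
          define j where "j = (LEAST j. (f ^^ j) z \<in> K)"
          have jK: "(f ^^ j) z \<in> K"
            using True LeastI unfolding j_def by metis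
          have "j < n"
            using True Least_le order.strict_trans1 unfolding j_def by metis
          have before: "\<phi> ((f ^^ i) z) \<in> U0" if "i < j" for i
            using not_less_Least[of i "\<lambda>j. (f ^^ j) z \<in> K"] that by (simp add: j_def K_def)
          obtain c where c: "c \<in> Z" "(f ^^ j) z \<in> W c" using jK Z(3) by auto
          have after: "\<phi> ((f ^^ i) z) \<in> u ((f ^^ (i - j)) c)" if "\<not> i < j" for i
          proof -
            have "(f ^^ i) z = (f ^^ (i - j)) ((f ^^ j) z)"
              using that by (simp flip: funpow_add[THEN fun_cong, unfolded o_apply])
            then show ?thesis using follow[OF c, of "i - j"] by simp
          qed
          have "x \<in> S n (itin j c)"
            using x before after by (auto simp: S_def z it itin_def)
          then show ?thesis using \<open>j < n\<close> c(1) by (auto simp: \<V>_def)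
        qed
      qed
    qed
    ultimately have "min_subcover_card X (iterated_join X g \<U> n) \<le> card \<V>"
      by (rule min_subcover_card_le)
    also have "\<dots> \<le> 1 + card ((\<lambda>(j, c). S n (itin j c)) ` ({..<n} \<times> Z))"
      unfolding \<V>_def using Z(2) by (simp add: card_insert_if)
    also have "\<dots> \<le> 1 + card ({..<n} \<times> Z)"
      using card_image_le[of "{..<n} \<times> Z"] Z(2) by simp
    also have "\<dots> = 1 + n * card Z" by (simp add: card_cartesian_product)
    finally show ?thesis .
  qed
  then show ?thesis by (rule that)
qed

lemma topological_entropy_collapsed:
  fixes f :: "'a::metric_space \<Rightarrow> 'a"
  assumes "compact (UNIV :: 'a set)"
    and "continuous_map euclidean X \<phi>" and "range \<phi> = topspace X"
    and "g \<circ> \<phi> = \<phi> \<circ> f"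
    and "\<And>x e. x \<notin> J \<Longrightarrow> e > 0 \<Longrightarrow>
      \<exists>U. open U \<and> x \<in> U \<and> (\<forall>n. \<forall>y\<in>U. dist ((f ^^ n) x) ((f ^^ n) y) < e)"
    and "\<And>x y. x \<in> J \<Longrightarrow> y \<in> J \<Longrightarrow> \<phi> x = \<phi> y"
  shows "topological_entropy X g = 0"
proof -
  have "cover_entropy X g \<U> = 0" if "open_cover X \<U>" for \<U>
    using min_subcover_card_collapsed[OF assms that] cover_entropy_linear_growth by metis
  \<comment> \<open>A cover exists, so the supremum is not over the empty set, where it would be
    \<open>-\<infinity>\<close>.\<close>
  moreover have "open_cover X {topspace X}"
    by (simp add: open_cover_def)
  ultimately show ?thesis
    unfolding topological_entropy_def
    by (intro antisym SUP_least SUP_upper2[of "{topspace X}"]) auto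
qed

section \<open>Normal families\<close>

text \<open>One half of the Arzela-Ascoli theorem. If equicontinuity failed at \<open>x\<close>,
  there would be points tending to \<open>x\<close> whose images under members of \<open>F\<close>
  stay at least \<open>e\<close> away from the image of \<open>x\<close>; along a uniformly
  convergent subsequence this contradicts continuity of the limit.\<close>

lemma normal_family_on_equicontinuous:
  fixes F :: "('a::metric_space \<Rightarrow> 'b::metric_space) set"
  assumes normal: "normal_family_on U F" and "open U" "x \<in> U"
    and cont: "\<And>f. f \<in> F \<Longrightarrow> continuous_on UNIV f" and "e > 0"
  shows "\<exists>V. open V \<and> x \<in> V \<and> (\<forall>f\<in>F. \<forall>y\<in>V. dist (f x) (f y) < e)"
proof (rule ccontr)
  assume neg: "\<not> ?thesis"
  obtain \<delta> where "\<delta> > 0" and \<delta>: "ball x \<delta> \<subseteq> U"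
    using \<open>open U\<close> \<open>x \<in> U\<close> openE by blast
  have "\<exists>f y. f \<in> F \<and> y \<in> ball x (\<delta> / real (Suc n)) \<and> \<not> dist (f x) (f y) < e" for n
  proof -
    have "open (ball x (\<delta> / real (Suc n)))" "x \<in> ball x (\<delta> / real (Suc n))"
      using \<open>\<delta> > 0\<close> by auto
    then show ?thesis using neg by blast
  qed
  then obtain f y where f: "\<And>n. f n \<in> F" and y: "\<And>n. y n \<in> ball x (\<delta> / real (Suc n))"
    and far: "\<And>n. \<not> dist (f n x) (f n (y n)) < e"
    by metis
  have "(\<lambda>n. dist (y n) x) \<longlonglongrightarrow> 0"
  proof (rule tendsto_sandwich[OF _ _ tendsto_const])
    show "\<forall>\<^sub>F n in sequentially. dist (y n) x \<le> \<delta> / real (Suc n)"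
      using y by (auto simp: dist_commute intro!: always_eventually less_imp_le)
    show "(\<lambda>n. \<delta> / real (Suc n)) \<longlonglongrightarrow> 0"
      by (rule LIMSEQ_Suc[OF lim_const_over_n])
  qed simp
  then have lim: "y \<longlonglongrightarrow> x" by (subst tendsto_dist_iff)
  \<comment> \<open>A convergent sequence together with its limit is compact, and the radii, at most
    \<open>\<delta>\<close>, keep it inside \<open>U\<close>; normality thus gives uniform
    convergence on it.\<close>
  define K where "K = insert x (range y)"
  have K: "compact K"
    using compactin_sequence_with_limit[of euclidean y x "range y"] lim by (simp add: K_def)
  have "ball x (\<delta> / real (Suc n)) \<subseteq> ball x \<delta>" for n
  proof (rule subset_ball)
    have "\<delta> * 1 \<le> \<delta> * real (Suc n)"
      using \<open>\<delta> > 0\<close> by (intro mult_left_mono) auto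
    then show "\<delta> / real (Suc n) \<le> \<delta>"
      by (subst pos_divide_le_eq) auto
  qed
  then have "y n \<in> U" for n using y \<delta> by blast
  then have KU: "K \<subseteq> U" using \<open>x \<in> U\<close> by (auto simp: K_def)
  obtain g k where k: "strict_mono (k :: nat \<Rightarrow> nat)"
    and unif: "uniform_limit K (f \<circ> k) g sequentially"
    using normal f K KU unfolding normal_family_on_def by (metis image_subset_iff)
  have "continuous_on K g"
    by (rule uniform_limit_theorem[OF _ unif])
      (auto intro!: always_eventually continuous_on_subset[OF cont] f)
  moreover have "(y \<circ> k) \<longlonglongrightarrow> x"
    using lim k by (rule LIMSEQ_subseq_LIMSEQ)
  ultimately have "(\<lambda>n. g ((y \<circ> k) n)) \<longlonglongrightarrow> g x"
    by (rule continuous_on_tendsto_compose) (auto simp: K_def)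
  then have "\<forall>\<^sub>F n in sequentially. dist (g (y (k n))) (g x) < e / 3"
    using \<open>e > 0\<close> by (intro tendstoD) auto
  moreover have "\<forall>\<^sub>F n in sequentially. \<forall>z\<in>K. dist (f (k n) z) (g z) < e / 3"
    using uniform_limitD[OF unif, of "e / 3"] \<open>e > 0\<close> by simp
  ultimately have "\<forall>\<^sub>F n in sequentially. False"
  proof eventually_elim
    case (elim n)
    have "dist (f (k n) x) (g x) < e / 3" "dist (f (k n) (y (k n))) (g (y (k n))) < e / 3"
      using elim by (auto simp: K_def)
    then have "dist (f (k n) x) (f (k n) (y (k n))) < e"
      using elim(1) dist_triangle[of "f (k n) x" "f (k n) (y (k n))" "g x"]
        dist_triangle[of "g x" "f (k n) (y (k n))" "g (y (k n))"]
      by (simp add: dist_commute)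
    then show ?case using far by blast
  qed
  then show False by simp
qed

section \<open>Invariance of the Julia set\<close>

lemma continuous_on_funpow:
  fixes f :: "'a::topological_space \<Rightarrow> 'a"
  assumes "continuous_on UNIV f"
  shows "continuous_on UNIV (f ^^ n)"
proof (induction n)
  case (Suc n)
  then show ?case
    by (auto intro: continuous_on_compose2[OF assms])
qed (simp add: id_def)

text \<open>An iterate of positive order \<open>n\<close> is \<open>R ^^ (n - 1)\<close> after
  \<open>R\<close>, so uniform convergence on the image of a compact set under \<open>R\<close>
  pulls back to that set.\<close>

lemma fatou_set_vimage:
  assumes cont: "continuous_on UNIV R" and fatou: "R z \<in> fatou_set R"
  shows "z \<in> fatou_set R"
proof -
  obtain U where U: "open U" "R z \<in> U" and normal: "normal_family_on U (range (\<lambda>n. R ^^ n))"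
    using fatou by (auto simp: fatou_set_def)
  have "normal_family_on (R -` U) (range (\<lambda>n. R ^^ n))"
    unfolding normal_family_on_def
  proof (intro allI impI)
    fix f :: "nat \<Rightarrow> riemann_sphere \<Rightarrow> riemann_sphere"
    assume "range f \<subseteq> range (\<lambda>n. R ^^ n)"
    then have "\<forall>i. \<exists>n. f i = R ^^ n" by auto
    then obtain a where a: "\<And>i. f i = R ^^ a i" by metis
    show "\<exists>g k. strict_mono (k :: nat \<Rightarrow> nat) \<and>
      (\<forall>K. compact K \<and> K \<subseteq> R -` U \<longrightarrow> uniform_limit K (f \<circ> k) g sequentially)"
    \<comment> \<open>The zeroth iterate does not factor through \<open>R\<close> in this way. If it
      occurs infinitely often, it forms a constant subsequence; otherwise a shift by
      \<open>M\<close> removes it.\<close>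
    proof (cases "infinite {i. a i = 0}")
      case True
      then obtain k where "strict_mono (k :: nat \<Rightarrow> nat)" "\<forall>i. k i \<in> {i. a i = 0}"
        using infinite_enumerate by blast
      moreover from this have "f \<circ> k = (\<lambda>_. id)" by (auto simp: a fun_eq_iff)
      ultimately show ?thesis
        by (intro exI[of _ id] exI[of _ k]) (auto simp: uniform_limit_const)
    next
      case False
      then obtain M where M: "\<And>i. a i = 0 \<Longrightarrow> i < M"
        unfolding not_not finite_nat_set_iff_bounded by blast
      define h where "h i = R ^^ (a (i + M) - 1)" for i
      have fh: "f (i + M) x = h i (R x)" for i x
      proof -
        have "a (i + M) \<noteq> 0" using M[of "i + M"] by auto
        then obtain b where "a (i + M) = Suc b" using not0_implies_Suc by blast
        then show ?thesis by (simp add: a h_def funpow_swap1)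
      qed
      have "range h \<subseteq> range (\<lambda>n. R ^^ n)" by (auto simp: h_def)
      then obtain g k where k: "strict_mono (k :: nat \<Rightarrow> nat)"
        and lim: "\<And>K. compact K \<Longrightarrow> K \<subseteq> U \<Longrightarrow> uniform_limit K (h \<circ> k) g sequentially"
        using normal unfolding normal_family_on_def by metis
      have "uniform_limit K (f \<circ> (\<lambda>i. k i + M)) (g \<circ> R) sequentially"
        if "compact K" "K \<subseteq> R -` U" for K
      proof -
        have "uniform_limit (R ` K) (h \<circ> k) g sequentially"
          using that by (intro lim compact_continuous_image continuous_on_subset[OF cont]) auto
        then show ?thesis
          by (simp add: uniform_limit_iff fh)
      qed
      moreover have "strict_mono (\<lambda>i. k i + M)" using k by (simp add: strict_mono_def)
      ultimately show ?thesis by blast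
    qed
  qed
  moreover have "open (R -` U)" using cont U(1) by (simp add: continuous_on_open_vimage)
  ultimately show ?thesis using U(2) by (auto simp: fatou_set_def)
qed

lemma julia_set_funpow:
  assumes "continuous_on UNIV R" "z \<in> julia_set R"
  shows "(R ^^ n) z \<in> julia_set R"
  by (induction n) (use assms fatou_set_vimage in \<open>auto simp: julia_set_def\<close>)

section \<open>Topology of the Riemann sphere\<close>

lemma continuous_on_stereo: "continuous_on A stereo"
  unfolding continuous_on_iff dist_riemann_sphere_def by blast

text \<open>The metric is pulled back along \<open>stereo\<close>, which is therefore an isometric
  embedding, so continuity can be tested in the ambient vector space.\<close>

lemma continuous_on_riemann_sphere_iff:
  fixes f :: "'a::topological_space \<Rightarrow> riemann_sphere"
  shows "continuous_on A f \<longleftrightarrow> continuous_on A (\<lambda>x. stereo (f x))"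
  unfolding continuous_on_def tendsto_iff dist_riemann_sphere_def by blast

lemma stereo_Fin_decomp:
  obtains s where "s = 1 + (cmod z)\<^sup>2" "s > 0" "stereo (Fin z) = ((2 / s) *\<^sub>R z, 1 - 2 / s)"
proof (rule that)
  show "stereo (Fin z) = ((2 / (1 + (cmod z)\<^sup>2)) *\<^sub>R z, 1 - 2 / (1 + (cmod z)\<^sup>2))"
    using stereo_Fin_snd[of z] by (intro prod_eqI) auto
qed (simp_all add: add_pos_nonneg)

lemma snd_stereo_eq_1_iff: "snd (stereo x) = 1 \<longleftrightarrow> x = Infty"
proof (cases x)
  case (Fin z)
  then show ?thesis by (rule_tac stereo_Fin_decomp[of z]) simp
qed simp

lemma snd_stereo_eq_minus_1_iff: "snd (stereo x) = -1 \<longleftrightarrow> x = Fin 0"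
proof (cases x)
  case (Fin z)
  then show ?thesis by (rule_tac stereo_Fin_decomp[of z]) (simp add: field_simps)
qed simp

lemma range_stereo: "range stereo = sphere 0 1"
proof
  show "range stereo \<subseteq> sphere 0 1"
  proof (clarsimp simp: norm_Pair)
    fix x
    have "(norm (fst (stereo x)))\<^sup>2 + (snd (stereo x))\<^sup>2 = 1"
    proof (cases x)
      case (Fin z)
      obtain s where s: "s = 1 + (cmod z)\<^sup>2" "s > 0" "stereo (Fin z) = ((2 / s) *\<^sub>R z, 1 - 2 / s)"
        by (rule stereo_Fin_decomp)
      have "(norm (fst (stereo x)))\<^sup>2 = 4 * (s - 1) / s\<^sup>2"
        by (simp only: Fin s(3) fst_conv norm_scaleR power_mult_distrib) (simp add: s(1) power_divide)
      moreover have "(snd (stereo x))\<^sup>2 = (1 - 2 / s)\<^sup>2"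
        by (simp only: Fin s(3) snd_conv)
      ultimately show ?thesis using s(2)
        by (simp only:) (simp add: field_simps power2_eq_square)
    qed simp
    then show "norm (stereo x) = 1"
      by (cases "stereo x") (simp add: norm_Pair)
  qed
  show "sphere 0 1 \<subseteq> range stereo"
  proof
    fix s :: "complex \<times> real"
    obtain w t where s: "s = (w, t)" by (cases s)
    assume "s \<in> sphere 0 1"
    then have eq: "(cmod w)\<^sup>2 = (1 - t) * (1 + t)"
      by (simp add: s norm_Pair power2_eq_square algebra_simps)
    show "s \<in> range stereo"
    proof (cases "t = 1")
      case True
      then have "s = stereo Infty" using eq by (simp add: s)
      then show ?thesis by blast
    next
      case False
      have "t \<le> 1"
      proof (rule ccontr)
        assume "\<not> t \<le> 1"
        then have "(1 - t) * (1 + t) < 0" by (intro mult_neg_pos) auto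
        then show False using eq by (metis not_less zero_le_power2)
      qed
      then have t: "1 - t > 0" using False by simp
      \<comment> \<open>Stereographic projection from the north pole \<open>(0, 1)\<close> supplies
        the preimage.\<close>
      define z where "z = w /\<^sub>R (1 - t)"
      have "(cmod z)\<^sup>2 = (cmod w)\<^sup>2 / (1 - t)\<^sup>2"
        using t by (simp add: z_def power_divide power_mult_distrib divide_inverse power_inverse)
      then have "(cmod z)\<^sup>2 = (1 + t) / (1 - t)"
        using t unfolding eq by (simp add: power2_eq_square)
      then have "1 + (cmod z)\<^sup>2 = 2 / (1 - t)" "(cmod z)\<^sup>2 - 1 = 2 * t / (1 - t)"
        using t by (simp_all add: field_simps)
      then have "2 / (1 + (cmod z)\<^sup>2) = 1 - t" "((cmod z)\<^sup>2 - 1) / (1 + (cmod z)\<^sup>2) = t"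
        using t by simp_all
      then have "s = stereo (Fin z)"
        unfolding s stereo.simps using t by (simp only:) (simp add: z_def)
      then show ?thesis by blast
    qed
  qed
qed

text \<open>The space is the image of the compact unit sphere under the inverse of the isometry
  \<open>stereo\<close>.\<close>

lemma compact_riemann_sphere: "compact (UNIV :: riemann_sphere set)"
proof -
  have inj: "inj stereo" by (simp add: inj_def stereo_eq_iff)
  have "continuous_on (range stereo) (inv stereo)"
    by (simp add: continuous_on_riemann_sphere_iff inj f_inv_into_f cong: continuous_on_cong)
  moreover have "compact (range stereo)" by (simp add: range_stereo)
  ultimately have "compact (inv stereo ` range stereo)"
    by (rule compact_continuous_image)
  then show ?thesis using inj by (simp add: image_image)
qed

text \<open>The distance depends only on the height \<open>h = snd (stereo x)\<close>: the argument
  of the square root is \<open>(1 - h) / 2\<close>, a formula that also gives the right value at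
  \<open>Infty\<close>.\<close>

lemma continuous_on_fs_dist0: "continuous_on UNIV fs_dist0"
proof -
  have eq: "fs_dist0 x = 2 / pi * arccos (sqrt ((1 - snd (stereo x)) / 2))" for x
  proof (cases x)
    case (Fin z)
    have "1 - snd (stereo (Fin z)) = 2 * (1 / (1 + (cmod z)\<^sup>2))"
      unfolding stereo_Fin_snd by simp
    then have "(1 - snd (stereo (Fin z))) / 2 = 1 / (1 + (cmod z)\<^sup>2)"
      by (metis nonzero_mult_div_cancel_left zero_neq_numeral)
    then show ?thesis by (simp only: Fin fs_dist0.simps)
  qed simp
  \<comment> \<open>This keeps the argument of \<open>arccos\<close> in \<open>[-1, 1]\<close>,
    where it is continuous.\<close>
  have bound: "0 \<le> (1 - snd (stereo x)) / 2 \<and> (1 - snd (stereo x)) / 2 \<le> 1" for x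
  proof -
    have "norm (snd (stereo x)) \<le> norm (stereo x)" by (metis norm_snd_le prod.collapse)
    also have "\<dots> = 1" using range_stereo by auto
    finally show ?thesis by auto
  qed
  have "0 \<le> sqrt ((1 - snd (stereo x)) / 2)" for x
    using bound by simp
  then have "-1 \<le> sqrt ((1 - snd (stereo x)) / 2)" for x
    by (rule order_trans[rotated]) simp
  moreover have "sqrt ((1 - snd (stereo x)) / 2) \<le> 1" for x
    using bound by (metis real_sqrt_le_mono real_sqrt_one)
  ultimately show ?thesis
    unfolding eq by (intro continuous_intros continuous_on_stereo) auto
qed

section \<open>Continuity of rational maps\<close>

text \<open>The point of the unit sphere with homogeneous coordinates \<open>[a : b]\<close>.\<close>

definition proj_stereo :: "complex \<Rightarrow> complex \<Rightarrow> complex \<times> real" where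
  "proj_stereo a b =
     ((2 / ((cmod a)\<^sup>2 + (cmod b)\<^sup>2)) *\<^sub>R (a * cnj b),
      ((cmod a)\<^sup>2 - (cmod b)\<^sup>2) / ((cmod a)\<^sup>2 + (cmod b)\<^sup>2))"

text \<open>Multiplying numerators and denominators by the square of \<open>cmod b\<close> turns the
  coordinates of \<open>a / b\<close> into expressions that stay meaningful for
  \<open>b = 0\<close>.\<close>

lemma stereo_quotient:
  assumes "a \<noteq> 0 \<or> b \<noteq> 0"
  shows "stereo (if b = 0 then Infty else Fin (a / b)) = proj_stereo a b"
proof (cases "b = 0")
  case True
  then show ?thesis using assms by (simp add: proj_stereo_def)
next
  case False
  have pos: "(cmod a)\<^sup>2 + (cmod b)\<^sup>2 > 0" using False by (simp add: add_nonneg_pos)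
  have "1 + (cmod (a / b))\<^sup>2 = ((cmod a)\<^sup>2 + (cmod b)\<^sup>2) / (cmod b)\<^sup>2"
    "(cmod (a / b))\<^sup>2 - 1 = ((cmod a)\<^sup>2 - (cmod b)\<^sup>2) / (cmod b)\<^sup>2"
    using False by (simp_all add: norm_divide power_divide field_simps)
  moreover have "((cmod b)\<^sup>2) *\<^sub>R (a / b) = a * cnj b"
    using False
    by (simp add: scaleR_conv_of_real complex_norm_square field_simps flip: of_real_power)
  ultimately show ?thesis using False pos
    by (simp add: proj_stereo_def) (metis divide_inverse mult.commute scaleR_scaleR times_divide_eq_right)
qed

text \<open>All numerators and denominators acquire the same factor, the square of
  \<open>cmod c\<close>.\<close>

lemma proj_stereo_scale:
  assumes "c \<noteq> 0"
  shows "proj_stereo (c * a) (c * b) = proj_stereo a b"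
proof -
  have "(c * a) * cnj (c * b) = (cmod c)\<^sup>2 *\<^sub>R (a * cnj b)"
    by (simp add: scaleR_conv_of_real complex_norm_square algebra_simps flip: of_real_power)
  moreover have "(cmod (c * a))\<^sup>2 + (cmod (c * b))\<^sup>2 = (cmod c)\<^sup>2 * ((cmod a)\<^sup>2 + (cmod b)\<^sup>2)"
    "(cmod (c * a))\<^sup>2 - (cmod (c * b))\<^sup>2 = (cmod c)\<^sup>2 * ((cmod a)\<^sup>2 - (cmod b)\<^sup>2)"
    by (simp_all add: norm_mult power_mult_distrib algebra_simps)
  ultimately show ?thesis using assms unfolding proj_stereo_def by simp
qed

lemma continuous_on_proj_stereo:
  assumes "continuous_on A a" "continuous_on A b" "\<And>x. x \<in> A \<Longrightarrow> a x \<noteq> 0 \<or> b x \<noteq> 0"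
  shows "continuous_on A (\<lambda>x. proj_stereo (a x) (b x))"
proof -
  have "(cmod (a x))\<^sup>2 + (cmod (b x))\<^sup>2 \<noteq> 0" if "x \<in> A" for x
    using assms(3)[OF that] by (auto simp: sum_power2_eq_zero_iff)
  then show ?thesis
    unfolding proj_stereo_def by (intro continuous_intros assms) auto
qed

text \<open>Stereographic projection from the north pole recovers the affine coordinate; its
  denominator vanishes only at \<open>Infty\<close>.\<close>

lemma coord_exists:
  obtains c where "continuous_on (- {Infty}) c" "\<And>z. c (Fin z) = z"
proof
  let ?c = "\<lambda>x. fst (stereo x) /\<^sub>R (1 - snd (stereo x))"
  show "continuous_on (- {Infty}) ?c"
    by (intro continuous_intros continuous_on_stereo)
      (metis ComplD eq_iff_diff_eq_0 insertI1 snd_stereo_eq_1_iff)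
  show "?c (Fin z) = z" for z
  proof -
    obtain s where "s > 0" "stereo (Fin z) = ((2 / s) *\<^sub>R z, 1 - 2 / s)"
      by (rule stereo_Fin_decomp)
    then show ?thesis by (simp del: stereo.simps)
  qed
qed

text \<open>Projection from the south pole gives \<open>1 / cnj z\<close>; conjugation turns this
  into the coordinate \<open>1 / z\<close> near infinity.\<close>

lemma inverse_coord_exists:
  obtains c where "continuous_on (- {Fin 0}) c" "c Infty = 0" "\<And>z. c (Fin z) = inverse z"
proof
  let ?c = "\<lambda>x. cnj (fst (stereo x)) /\<^sub>R (1 + snd (stereo x))"
  have "1 + snd (stereo x) \<noteq> 0" if "x \<noteq> Fin 0" for x
    using that snd_stereo_eq_minus_1_iff[of x] by linarith
  then show "continuous_on (- {Fin 0}) ?c"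
    by (intro continuous_intros continuous_on_stereo) auto
  show "?c Infty = 0" by simp
  show "?c (Fin z) = inverse z" for z
  \<comment> \<open>At 0 both sides are 0, the right one by the convention
    \<open>inverse 0 = 0\<close>.\<close>
  proof (cases "z = 0")
    case False
    obtain s where s: "s = 1 + (cmod z)\<^sup>2" "s > 0" "stereo (Fin z) = ((2 / s) *\<^sub>R z, 1 - 2 / s)"
      by (rule stereo_Fin_decomp)
    have "1 + snd (stereo (Fin z)) = (2 / s) * (cmod z)\<^sup>2"
    proof -
      have "1 + snd (stereo (Fin z)) = (2 / s) * (s - 1)"
        using s(2) by (simp add: s(3) field_simps del: stereo.simps)
      then show ?thesis by (simp only: s(1)) simp
    qed
    then have "?c (Fin z) = cnj z /\<^sub>R (cmod z)\<^sup>2"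
      using s(2) by (simp add: s(3) inverse_eq_divide del: stereo.simps)
    also have "\<dots> = inverse z"
      using False
      by (simp add: scaleR_conv_of_real complex_norm_square field_simps flip: of_real_power)
    finally show ?thesis .
  qed simp
qed

text \<open>The polynomial reversed in formal degree \<open>m\<close>, that is,
  \<open>u ^ m * poly p (1 / u)\<close> for nonzero \<open>u\<close> if \<open>degree p\<close> is
  at most \<open>m\<close>. The formal degree is a parameter so that numerator and denominator can
  share it.\<close>

definition rev_eval :: "nat \<Rightarrow> complex poly \<Rightarrow> complex \<Rightarrow> complex" where
  "rev_eval m p u = (\<Sum>i\<le>m. coeff p i * u ^ (m - i))"

lemma rev_eval_0: "rev_eval m p 0 = coeff p m"
proof -
  have "rev_eval m p 0 = (\<Sum>i\<le>m. if i = m then coeff p i else 0)"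
    unfolding rev_eval_def by (intro sum.cong) (auto simp: power_0_left)
  then show ?thesis by simp
qed

lemma rev_eval_inverse:
  assumes "degree p \<le> m" "z \<noteq> 0"
  shows "rev_eval m p (inverse z) = inverse z ^ m * poly p z"
proof -
  have "coeff p i * inverse z ^ (m - i) = inverse z ^ m * (coeff p i * z ^ i)" if "i \<le> m" for i
  proof -
    have "inverse z ^ m * z ^ i = inverse z ^ (m - i) * (inverse z * z) ^ i"
      using that by (simp only: power_mult_distrib mult.assoc[symmetric] flip: power_add) simp
    also have "\<dots> = inverse z ^ (m - i)" using assms(2) by simp
    finally show ?thesis by (metis mult.left_commute)
  qed
  then have "rev_eval m p (inverse z) = inverse z ^ m * (\<Sum>i\<le>m. coeff p i * z ^ i)"
    unfolding rev_eval_def sum_distrib_left by (intro sum.cong) auto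
  also have "(\<Sum>i\<le>m. coeff p i * z ^ i) = poly p z"
    unfolding poly_altdef using assms(1)
    by (intro sum.mono_neutral_right) (auto simp: coeff_eq_0)
  finally show ?thesis .
qed

text \<open>In homogeneous coordinates the map is given by \<open>p\<close> and \<open>q\<close>
  away from infinity and by the reversed polynomials in \<open>1 / z\<close> away from 0.
  Coprimality excludes a common zero at finite points, positive degree excludes one at
  infinity.\<close>

lemma continuous_on_rat_eval:
  assumes coprime: "coprime p q" and deg: "max (degree p) (degree q) > 0"
  shows "continuous_on UNIV (rat_eval p q)"
proof -
  define m where "m = max (degree p) (degree q)"
  have poly_nz: "poly p z \<noteq> 0 \<or> poly q z \<noteq> 0" for z
    using coprime_poly_0[OF coprime] by blast
  have stereo_Fin: "stereo (rat_eval p q (Fin z)) = proj_stereo (poly p z) (poly q z)" for z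
    using stereo_quotient[OF poly_nz] by simp
  \<comment> \<open>One of the two polynomials has degree exactly \<open>m\<close>; as
    \<open>m\<close> is positive, it is nonzero and has its leading coefficient there.\<close>
  have lead_nz: "coeff p m \<noteq> 0 \<or> coeff q m \<noteq> 0"
    using deg unfolding m_def max_def by (metis degree_0 leading_coeff_0_iff less_irrefl)
  have stereo_Infty: "stereo (rat_eval p q Infty) = proj_stereo (coeff p m) (coeff q m)"
    using stereo_quotient[OF lead_nz] by (simp only: m_def Let_def rat_eval.simps)
  obtain c where c: "continuous_on (- {Infty}) c" "\<And>z. c (Fin z) = z"
    using coord_exists by metis
  have "continuous_on (- {Infty}) (\<lambda>x. proj_stereo (poly p (c x)) (poly q (c x)))"
    by (intro continuous_on_proj_stereo continuous_intros c poly_nz)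
  moreover have c_eq: "stereo (rat_eval p q x) = proj_stereo (poly p (c x)) (poly q (c x))"
    if "x \<in> - {Infty}" for x
    using that by (cases x) (simp_all only: stereo_Fin c, simp)
  ultimately have near_Fin: "continuous_on (- {Infty}) (rat_eval p q)"
    unfolding continuous_on_riemann_sphere_iff by (intro continuous_on_eq[OF _ c_eq[symmetric]])
  obtain k where k: "continuous_on (- {Fin 0}) k" "k Infty = 0" "\<And>z. k (Fin z) = inverse z"
    using inverse_coord_exists by metis
  have rev: "rev_eval m p (inverse z) = inverse z ^ m * poly p z"
    "rev_eval m q (inverse z) = inverse z ^ m * poly q z" if "z \<noteq> 0" for z
    using that by (simp_all add: rev_eval_inverse m_def)
  have rev_nz: "rev_eval m p (k x) \<noteq> 0 \<or> rev_eval m q (k x) \<noteq> 0" if "x \<in> - {Fin 0}" for x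
    using that poly_nz lead_nz by (cases x) (auto simp: k rev rev_eval_0)
  have "continuous_on (- {Fin 0}) (\<lambda>x. proj_stereo (rev_eval m p (k x)) (rev_eval m q (k x)))"
    unfolding rev_eval_def
    by (intro continuous_on_proj_stereo continuous_intros k(1) rev_nz[unfolded rev_eval_def])
  moreover have k_eq: "stereo (rat_eval p q x) = proj_stereo (rev_eval m p (k x)) (rev_eval m q (k x))"
    if "x \<in> - {Fin 0}" for x
  proof (cases x)
    case (Fin z)
    then have "z \<noteq> 0" using that by auto
    \<comment> \<open>The reversed polynomials differ from \<open>p\<close> and \<open>q\<close> by
      the common factor \<open>inverse z ^ m\<close>, which homogeneous coordinates ignore.\<close>
    then show ?thesis
      unfolding \<open>x = Fin z\<close> stereo_Fin k rev[OF \<open>z \<noteq> 0\<close>] by (subst proj_stereo_scale) auto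
  qed (simp only: stereo_Infty k rev_eval_0)
  ultimately have near_Infty: "continuous_on (- {Fin 0}) (rat_eval p q)"
    unfolding continuous_on_riemann_sphere_iff by (intro continuous_on_eq[OF _ k_eq[symmetric]])
  have "continuous_on (- {Infty} \<union> - {Fin 0}) (rat_eval p q)"
    by (rule continuous_on_open_Un[OF _ _ near_Fin near_Infty]) auto
  moreover have "- {Infty} \<union> - {Fin 0} = UNIV" by auto
  ultimately show ?thesis by simp
qed

section \<open>Entropy of the map induced on distances to the origin\<close>

theorem proposition6:
  fixes R :: "riemann_sphere \<Rightarrow> riemann_sphere"
    and Q :: "(nat \<Rightarrow> real) \<Rightarrow> (nat \<Rightarrow> real)"
    and d N :: nat
  assumes "rational_map d R" and "d \<ge> 2"
    and "strongly_exceptional R"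
    and "determining_bound R N"
    and "Q \<circ> Phi R N = Phi R N \<circ> R"
  shows "topological_entropy (Omega_hat R N) Q = 0"
proof -
  have cont: "continuous_on UNIV R"
    using assms(1,2) continuous_on_rat_eval by (fastforce simp: rational_map_def)
  have "continuous_on UNIV (\<lambda>z. fs_dist0 ((R ^^ n) z))" for n
    by (rule continuous_on_compose2[OF continuous_on_fs_dist0 continuous_on_funpow[OF cont]]) simp
  then have "continuous_map euclidean (powertop_real {..N}) (Phi R N)"
    by (auto simp: continuous_map_componentwise Phi_def cong: restrict_cong)
  then have Phi_cont: "continuous_map euclidean (Omega_hat R N) (Phi R N)"
    by (simp add: Omega_hat_def continuous_map_in_subtopology)
  have Phi_range: "range (Phi R N) = topspace (Omega_hat R N)"
    by (auto simp: Omega_hat_def Phi_def PiE_def)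
  obtain r where r: "julia_set R \<subseteq> Fin ` {z. cmod z = r}"
    using assms(3) by (auto simp: strongly_exceptional_def)
  have fs: "fs_dist0 x = fs_dist0 y" if xy: "x \<in> julia_set R" "y \<in> julia_set R" for x y
  proof -
    obtain a b where "x = Fin a" "y = Fin b" "cmod a = r" "cmod b = r"
      using xy[THEN subsetD[OF r]] by auto
    then show ?thesis by simp
  qed
  show ?thesis
  proof (rule topological_entropy_collapsed[OF compact_riemann_sphere Phi_cont Phi_range assms(5)])
    fix x and e :: real assume "x \<notin> julia_set R" "e > 0"
    then obtain U where "open U" "x \<in> U" "normal_family_on U (range (\<lambda>n. R ^^ n))"
      by (auto simp: julia_set_def fatou_set_def)
    then have "\<exists>V. open V \<and> x \<in> V \<and> (\<forall>f\<in>range (\<lambda>n. R ^^ n). \<forall>y\<in>V. dist (f x) (f y) < e)"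
      using \<open>e > 0\<close> continuous_on_funpow[OF cont]
      by (intro normal_family_on_equicontinuous) auto
    then show "\<exists>U. open U \<and> x \<in> U \<and> (\<forall>n. \<forall>y\<in>U. dist ((R ^^ n) x) ((R ^^ n) y) < e)"
      by simp
  next
    fix x y assume "x \<in> julia_set R" "y \<in> julia_set R"
    \<comment> \<open>Invariance keeps both orbits in the Julia set, hence on the circle of radius
      \<open>r\<close>, where the distance to the origin is constant.\<close>
    then have "fs_dist0 ((R ^^ n) x) = fs_dist0 ((R ^^ n) y)" for n
      by (intro fs julia_set_funpow[OF cont])
    then show "Phi R N x = Phi R N y" by (simp add: Phi_def)
  qed
qed

end
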